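(* Let $\mathtt{Compress}:\Sigma^*\to(\Sigma')^*$ be the (non-overlapping) LZ77 compression function with unbounded sliding window size $W=n$, as described in the context. Then, for strings of length $n$, $$\mathrm{GS}_{\mathtt{Compress}}\le\Big(\tfrac{\sqrt[3]{9}}{2}n^{2/3}+\tfrac{\sqrt[3]{3}}{2}n^{1/3}+1\Big)\big(2\lceil\log n\rceil+\lceil\log|\Sigma|\rceil\big)=O(n^{2/3}\log n).$$
   Context: All logarithms are base 2. For $w\in\Sigma^n$, $w[i]$ is its $i$-th character and $w[a,b]$ the substring from position $a$ to $b$. Non-overlapping LZ77 with window $W\le n$: the output on $w\in\Sigma^n$ is a sequence of blocks $B_1,\dots,B_t$, $B_i=[q_i,\ell_i,c_i]$ with integers $0\le q_i,\ell_i<n$ and $c_i\in\Sigma$; set $s_i=1+\sum_{r<i}(\ell_r+1)$ and $f_i=s_i+\ell_i$, so $B_i$ encodes $w[s_i,f_i]$. Greedily, $B_1=[0,0,w[1]]$; if the first $\mathsf{ctc}<n$ characters have been encoded, the next block uses the largest $\ell\ge 0$ (with $\mathsf{ctc}+\ell<n$) such that $w[\mathsf{ctc}+1,\mathsf{ctc}+\ell]=w[z-\ell+1,z]$ for some $z$ with $\max\{0,\mathsf{ctc}-W\}+\ell\le z\le\mathsf{ctc}$; if $\ell=0$ the block is $[0,0,w[\mathsf{ctc}+1]]$, otherwise it is $[z-\ell+1,\ell,w[\mathsf{ctc}+\ell+1]]$; then $\mathsf{ctc}$ increases by $\ell+1$, and the algorithm stops when $\mathsf{ctc}=n$. Each block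 is encoded with $2\lceil\log n\rceil+\lceil\log|\Sigma|\rceil$ bits, so $|\mathtt{Compress}(w)|=t(2\lceil\log n\rceil+\lceil\log|\Sigma|\rceil)$. Strings $w,w'\in\Sigma^n$ are neighbors ($w\sim w'$) if they differ in exactly one position, and $\mathrm{GS}_{\mathtt{Compress}}=\max_{w\in\Sigma^n}\max_{w'\sim w}\big||\mathtt{Compress}(w)|-|\mathtt{Compress}(w')|\big|$. *)

theory Defs
  imports Complex_Main "HOL-Library.Countable_Set" "HOL-Library.Landau_Symbols"
begin

text \<open>Positions in strings are counted from 1, so the character at position \<open>i\<close> of \<open>w\<close> is
  \<open>w ! (i - 1)\<close>; \<open>substr w a b\<close> is the substring from position \<open>a\<close> to position \<open>b\<close>
  (empty if \<open>b < a\<close>), for \<open>1 \<le> a\<close> and \<open>b \<le> length w\<close>.\<close>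

definition substr :: "'a list \<Rightarrow> nat \<Rightarrow> nat \<Rightarrow> 'a list" where
  "substr w a b = take (Suc b - a) (drop (a - 1) w)"

text \<open>\<open>match_at W w ctc l z\<close>: the \<open>l\<close> characters following the encoded prefix of length \<open>ctc\<close>
  also occur inside the window, ending at position \<open>z\<close>. The truncated subtraction \<open>ctc - W\<close>
  is \<open>max 0 (ctc - W)\<close>.\<close>

definition match_at :: "nat \<Rightarrow> 'a list \<Rightarrow> nat \<Rightarrow> nat \<Rightarrow> nat \<Rightarrow> bool" where
  "match_at W w ctc l z \<longleftrightarrow>
     (ctc - W) + l \<le> z \<and> z \<le> ctc \<and>
     substr w (ctc + 1) (ctc + l) = substr w (z - l + 1) z"

definition match_length :: "nat \<Rightarrow> 'a list \<Rightarrow> nat \<Rightarrow> nat" where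
  "match_length W w ctc = Max {l. ctc + l < length w \<and> (\<exists>z. match_at W w ctc l z)}"

type_synonym 'a block = "nat \<times> nat \<times> 'a"

definition make_block :: "'a list \<Rightarrow> nat \<Rightarrow> nat \<Rightarrow> nat \<Rightarrow> 'a block" where
  "make_block w ctc l z =
     (if l = 0 then (0, 0, w ! ctc) else (z - l + 1, l, w ! (ctc + l)))"

text \<open>\<open>lz77_blocks W w ctc bs\<close>: \<open>bs\<close> is a possible block sequence for the part of \<open>w\<close> after its
  first \<open>ctc\<close> characters. This is a relation because the choice of the source \<open>z\<close> among several
  longest matches is left open. For \<open>ctc = 0\<close> only \<open>l = 0\<close> is possible, so the first block is
  \<open>(0, 0, w ! 0)\<close>.\<close>

inductive lz77_blocks :: "nat \<Rightarrow> 'a list \<Rightarrow> nat \<Rightarrow> 'a block list \<Rightarrow> bool"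
  for W :: nat and w :: "'a list" where
  stop: "lz77_blocks W w (length w) []"
| step: "\<lbrakk>ctc < length w; l = match_length W w ctc; match_at W w ctc l z;
          lz77_blocks W w (ctc + l + 1) bs\<rbrakk>
         \<Longrightarrow> lz77_blocks W w ctc (make_block w ctc l z # bs)"

text \<open>\<open>to_nat_on \<Sigma>\<close> is a bijection of the finite set \<open>\<Sigma>\<close> onto \<open>{..<card \<Sigma>}\<close>, and both numbers
  in a block are smaller than \<open>n\<close>, so all three fields fit their widths.\<close>

definition binary :: "nat \<Rightarrow> nat \<Rightarrow> bool list" where
  "binary k m = map (bit m) (rev [0..<k])"

definition encode_block :: "'a set \<Rightarrow> nat \<Rightarrow> 'a block \<Rightarrow> bool list" where
  "encode_block \<Sigma> n = (\<lambda>(q, l, c).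
     binary (nat \<lceil>log 2 (real n)\<rceil>) q @
     binary (nat \<lceil>log 2 (real n)\<rceil>) l @
     binary (nat \<lceil>log 2 (real (card \<Sigma>))\<rceil>) (to_nat_on \<Sigma> c))"

text \<open>\<open>compress\<close> is an LZ77 compression function over \<open>\<Sigma>\<close>, with any resolution of ties between
  longest matches. The window size \<open>W\<close> may depend on the string length.\<close>

definition lz77_compressor :: "(nat \<Rightarrow> nat) \<Rightarrow> 'a set \<Rightarrow> ('a list \<Rightarrow> bool list) \<Rightarrow> bool" where
  "lz77_compressor W \<Sigma> compress \<longleftrightarrow>
     (\<forall>w \<in> lists \<Sigma>. \<exists>bs. lz77_blocks (W (length w)) w 0 bs \<and>
        compress w = concat (map (encode_block \<Sigma> (length w)) bs))"

definition neighbors :: "'a list \<Rightarrow> 'a list \<Rightarrow> bool" where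
  "neighbors w w' \<longleftrightarrow>
     length w = length w' \<and> card {i. i < length w \<and> w ! i \<noteq> w' ! i} = 1"

text \<open>The inserted 0 only matters if there are no neighbors at all (a one-letter alphabet).\<close>

definition global_sensitivity :: "'a set \<Rightarrow> ('a list \<Rightarrow> 'b list) \<Rightarrow> nat \<Rightarrow> real" where
  "global_sensitivity \<Sigma> f n = Max (insert 0
     {\<bar>real (length (f w)) - real (length (f w'))\<bar> | w w'.
        w \<in> lists \<Sigma> \<and> w' \<in> lists \<Sigma> \<and> length w = n \<and> neighbors w w'})"

lemma match_length_matches:
  assumes "ctc < length w"
  shows "ctc + match_length W w ctc < length w"
    and "\<exists>z. match_at W w ctc (match_length W w ctc) z"
proof -
  let ?L = "{l. ctc + l < length w \<and> (\<exists>z. match_at W w ctc l z)}"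
  have "finite ?L"
    by (rule finite_subset[of _ "{..length w}"]) auto
  moreover have "match_at W w ctc 0 ctc"
    by (simp add: match_at_def substr_def)
  then have "0 \<in> ?L"
    using assms by auto
  ultimately have "match_length W w ctc \<in> ?L"
    unfolding match_length_def by (intro Max_in) blast+
  then show "ctc + match_length W w ctc < length w"
    and "\<exists>z. match_at W w ctc (match_length W w ctc) z"
    by auto
qed

lemma lz77_blocks_exist:
  "ctc \<le> length w \<Longrightarrow> \<exists>bs. lz77_blocks W w ctc bs"
proof (induction "length w - ctc" arbitrary: ctc rule: less_induct)
  case less
  show ?case
  proof (cases "ctc = length w")
    case True
    then show ?thesis
      using lz77_blocks.stop by blast
  next
    case False
    with less.prems have lt: "ctc < length w"
      by simp
    let ?l = "match_length W w ctc"
    have "ctc + ?l + 1 \<le> length w"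
      using match_length_matches(1)[OF lt, of W] by simp
    moreover have "length w - (ctc + ?l + 1) < length w - ctc"
      using lt by simp
    ultimately obtain bs where "lz77_blocks W w (ctc + ?l + 1) bs"
      using less.hyps[of "ctc + ?l + 1"] by blast
    moreover obtain z where "match_at W w ctc ?l z"
      using match_length_matches(2)[OF lt] by blast
    ultimately show ?thesis
      using lz77_blocks.step[OF lt refl] by blast
  qed
qed

lemma lz77_compressor_exists:
  fixes \<Sigma> :: "'a set"
  shows "\<exists>compress. lz77_compressor W \<Sigma> compress"
proof -
  have "\<forall>w :: 'a list. \<exists>bs. lz77_blocks (W (length w)) w 0 bs"
    by (simp add: lz77_blocks_exist)
  then obtain blocks where "\<forall>w :: 'a list. lz77_blocks (W (length w)) w 0 (blocks w)"
    by metis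
  then have "lz77_compressor W \<Sigma> (\<lambda>w. concat (map (encode_block \<Sigma> (length w)) (blocks w)))"
    unfolding lz77_compressor_def by blast
  then show ?thesis
    by blast
qed

end

(* Cut w' at the blocks of w. If neither a block of w nor its source meets the changed position p,
   then every w'-block starting in it reaches its end, so only one w'-block starts in it; otherwise
   the same argument on both sides of the changed character gives at most two. Two blocks of w
   outside p in which two w'-blocks start cannot have the same source and length, since the later
   one would be a copy of the earlier one; hence at most l of them have length l, namely one per
   source containing p. As such a block occupies l + 1 positions, a linear programming bound with
   cut-off near (3n)^(1/3) limits their number, and the block containing p contributes the +1. *)

theory Submission
  imports Defs "HOL-Real_Asymp.Real_Asymp"
begin

section \<open>Greedy parsing in terms of copies and starting positions\<close>

text \<open>Positions are 0-based and \<open>q\<close> is where the source starts. The condition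
  \<open>q + l <= c\<close> expresses that source and target do not overlap.\<close>

definition earlier_copy :: "'a list \<Rightarrow> nat \<Rightarrow> nat \<Rightarrow> nat \<Rightarrow> bool" where
  "earlier_copy w c l q \<longleftrightarrow> q + l \<le> c \<and> (\<forall>k<l. w ! (q + k) = w ! (c + k))"

lemma take_drop_eq_iff:
  assumes "a + l \<le> length w" "b + l \<le> length w"
  shows "take l (drop a w) = take l (drop b w) \<longleftrightarrow> (\<forall>k<l. w ! (a + k) = w ! (b + k))"
  using assms by (auto simp: list_eq_iff_nth_eq)

text \<open>For \<open>c <= W\<close> the truncated \<open>c - W\<close> is 0, so the window only
  demands \<open>l <= z <= c\<close>; the witnesses correspond by \<open>z = q + l\<close>.\<close>

lemma ex_match_at_iff:
  assumes "c \<le> W" "c + l \<le> length w"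
  shows "(\<exists>z. match_at W w c l z) \<longleftrightarrow> (\<exists>q. earlier_copy w c l q)"
proof
  assume "\<exists>z. match_at W w c l z"
  then obtain z where z: "l \<le> z" "z \<le> c" "take l (drop c w) = take l (drop (z - l) w)"
    using assms by (auto simp: match_at_def substr_def)
  then have "earlier_copy w c l (z - l)"
    using assms take_drop_eq_iff[of c l w "z - l"] by (auto simp: earlier_copy_def)
  then show "\<exists>q. earlier_copy w c l q" ..
next
  assume "\<exists>q. earlier_copy w c l q"
  then obtain q where q: "earlier_copy w c l q" ..
  then have "match_at W w c l (q + l)"
    using assms take_drop_eq_iff[of c l w q]
    by (auto simp: earlier_copy_def match_at_def substr_def)
  then show "\<exists>z. match_at W w c l z" ..
qed

text \<open>Greedy maximality enters the later argument only in this form.\<close>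

lemma match_length_ge:
  assumes "c + l < length w" "earlier_copy w c l q"
  shows "l \<le> match_length (length w) w c"
proof -
  have "\<exists>z. match_at (length w) w c l z"
    using ex_match_at_iff[of c "length w" l w] assms by auto
  moreover have "finite {l. c + l < length w \<and> (\<exists>z. match_at (length w) w c l z)}"
    by (rule finite_subset[of _ "{..length w}"]) auto
  ultimately show ?thesis
    unfolding match_length_def using assms(1) by (intro Max_ge) auto
qed

lemma match_length_copy:
  assumes "c < length w"
  shows "\<exists>q. earlier_copy w c (match_length (length w) w c) q"
  using ex_match_at_iff[of c "length w" "match_length (length w) w c" w]
    match_length_matches[OF assms, of "length w"] assms by auto

text \<open>\<open>S\<close> is the set of the (0-based) starting positions of the greedy blocks of \<open>w\<close> from
  position \<open>c\<close> on, for an unbounded window.\<close>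

definition parse_starts :: "'a list \<Rightarrow> nat \<Rightarrow> nat set \<Rightarrow> bool" where
  "parse_starts w c S \<longleftrightarrow> S \<subseteq> {c..<length w} \<and>
     (\<forall>s\<in>S. s + match_length (length w) w s < length w) \<and>
     (\<forall>x\<in>{c..<length w}. \<exists>s\<in>S. x \<in> {s..s + match_length (length w) w s}) \<and>
     (\<forall>s\<in>S. \<forall>t\<in>S. s < t \<longrightarrow> s + match_length (length w) w s < t)"

text \<open>Block lengths are determined by \<open>w\<close> and the starting position, so keeping
  only the starts removes the choice among several longest matches.\<close>

lemma lz77_blocks_parse_starts:
  assumes "lz77_blocks (length w) w c bs"
  shows "\<exists>S. parse_starts w c S \<and> card S = length bs"
  using assms
proof induction
  case stop
  show ?case
    by (intro exI[of _ "{}"]) (simp add: parse_starts_def)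
next
  case (step c l z bs)
  then obtain S where S: "parse_starts w (c + l + 1) S" "card S = length bs"
    by blast
  have "c + l < length w"
    using match_length_matches(1)[OF step.hyps(1)] step.hyps(2) by simp
  have "finite S" and "c \<notin> S"
    using S(1) finite_subset unfolding parse_starts_def by fastforce+
  then have "card (insert c S) = length (make_block w c l z # bs)"
    using S(2) by simp
  moreover have "parse_starts w c (insert c S)"
    unfolding parse_starts_def
  proof (intro conjI ballI impI)
    show "insert c S \<subseteq> {c..<length w}"
      using S(1) step.hyps(1) by (auto simp: parse_starts_def)
  next
    fix s assume "s \<in> insert c S"
    then show "s + match_length (length w) w s < length w"
      using S(1) \<open>c + l < length w\<close> step.hyps(2) by (auto simp: parse_starts_def)
  next
    fix x assume x: "x \<in> {c..<length w}"
    show "\<exists>s\<in>insert c S. x \<in> {s..s + match_length (length w) w s}"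
    proof (cases "x \<le> c + l")
      case True
      then show ?thesis
        using x step.hyps(2) by auto
    next
      case False
      then have "x \<in> {c + l + 1..<length w}"
        using x by auto
      then show ?thesis
        using S(1) unfolding parse_starts_def by blast
    qed
  next
    fix s t assume "s \<in> insert c S" "t \<in> insert c S" "s < t"
    then show "s + match_length (length w) w s < t"
      using S(1) step.hyps(2) unfolding parse_starts_def by fastforce
  qed
  ultimately show ?case by blast
qed

section \<open>Cardinality bounds and the linear program\<close>

lemma card_le_Suc_0I:
  assumes "\<And>a b. a \<in> A \<Longrightarrow> b \<in> A \<Longrightarrow> a < b \<Longrightarrow> False"
  shows "card (A :: nat set) \<le> 1"
proof (cases "finite A")
  case True
  then show ?thesis
    using assms card_le_Suc0_iff_eq[of A] by (metis One_nat_def linorder_neqE_nat)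
qed simp

text \<open>Linear programming duality: each \<open>s\<close> satisfies \<open>y + 1 \<le> (f s + 1) + (y - f s)\<close>, where the
  truncated difference only charges the values below \<open>y\<close>.\<close>

lemma card_bound_of_fibres:
  fixes f :: "'b \<Rightarrow> nat"
  assumes "finite B" "(\<Sum>s\<in>B. f s + 1) \<le> n"
    and "\<And>l. card {s\<in>B. f s = l} \<le> l"
  shows "(y + 1) * card B \<le> n + (\<Sum>l\<le>y. l * (y - l))"
proof -
  have "(y + 1) * card B = (\<Sum>s\<in>B. y + 1)"
    by simp
  also have "\<dots> \<le> (\<Sum>s\<in>B. (f s + 1) + (y - f s))"
    by (intro sum_mono) auto
  also have "\<dots> = (\<Sum>s\<in>B. f s + 1) + (\<Sum>s\<in>B. y - f s)"
    by (rule sum.distrib)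
  also have "(\<Sum>s\<in>B. y - f s) = (\<Sum>s\<in>{s\<in>B. f s \<le> y}. y - f s)"
    using assms(1) by (intro sum.mono_neutral_right) auto
  also have "\<dots> = (\<Sum>l\<le>y. \<Sum>s\<in>{s\<in>{s\<in>B. f s \<le> y}. f s = l}. y - f s)"
    using assms(1) by (intro sum.group[symmetric]) auto
  also have "\<dots> = (\<Sum>l\<le>y. card {s\<in>B. f s = l} * (y - l))"
  proof (rule sum.cong[OF refl])
    fix l assume "l \<in> {..y}"
    then have "{s\<in>{s\<in>B. f s \<le> y}. f s = l} = {s\<in>B. f s = l}"
      by auto
    then show "(\<Sum>s\<in>{s\<in>{s\<in>B. f s \<le> y}. f s = l}. y - f s) = card {s\<in>B. f s = l} * (y - l)"
      by simp
  qed
  also have "\<dots> \<le> (\<Sum>l\<le>y. l * (y - l))"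
    using assms(3) by (intro sum_mono mult_right_mono) auto
  finally show ?thesis
    using assms(2) by linarith
qed

lemma sum_mult_diff:
  "6 * real (\<Sum>l\<le>y. l * (y - l)) = real y ^ 3 - real y"
proof -
  \<comment> \<open>The upper limit \<open>m\<close> and the coefficient \<open>c\<close> are
    separated so that the summand stays fixed during the induction.\<close>
  have "6 * (\<Sum>l\<le>m. real l * (c - real l)) = real m * (real m + 1) * (3 * c - 2 * real m - 1)"
    for m :: nat and c :: real
    by (induction m) (simp_all add: algebra_simps)
  from this[where m = y and c = "real y"] show ?thesis
    by (simp add: of_nat_diff algebra_simps power3_eq_cube)
qed

lemma card_bound_real:
  fixes f :: "'b \<Rightarrow> nat"
  assumes "finite B" "(\<Sum>s\<in>B. f s + 1) \<le> n"
    and "\<And>l. card {s\<in>B. f s = l} \<le> l"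
  shows "real (card B) \<le> root 3 9 / 2 * real n powr (2 / 3) + root 3 3 / 2 * real n powr (1 / 3)"
proof -
  \<comment> \<open>Up to lower order the bound is \<open>n / y + y^2 / 6\<close>, which is least at
    \<open>y^3 = 3 * n\<close>, with value \<open>y^2 / 2\<close>.\<close>
  define x where "x = root 3 (3 * real n)"
  define y where "y = nat \<lfloor>x\<rfloor>"
  define d where "d = x - real y"
  have x0: "x \<ge> 0" and x3: "x ^ 3 = 3 * real n"
    by (auto simp: x_def)
  have d: "0 \<le> d" "d \<le> 1"
    using x0 by (auto simp: d_def y_def) linarith+
  have "real ((y + 1) * card B) \<le> real (n + (\<Sum>l\<le>y. l * (y - l)))"
    using card_bound_of_fibres[OF assms, of y] by (simp only: of_nat_le_iff)
  then have "6 * ((real y + 1) * real (card B)) \<le> 6 * real n + (real y ^ 3 - real y)"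
    using sum_mult_diff[of y] by (simp add: algebra_simps)
  also have "\<dots> = 2 * x ^ 3 + real y ^ 3 - real y"
    using x3 by simp
  also have "\<dots> \<le> 3 * x * (x + 1) * (real y + 1)"
  proof -
    \<comment> \<open>Substituting \<open>x = y + d\<close> with the rounding error \<open>d\<close>
      in [0, 1] makes every summand visibly nonnegative.\<close>
    have "3 * x * (x + 1) * (real y + 1) - (2 * x ^ 3 + real y ^ 3 - real y) =
        6 * (real y)\<^sup>2 + real y * (4 + 6 * d + 3 * d * (1 - d)) + 3 * d + d\<^sup>2 * (3 - 2 * d)"
      unfolding d_def by (simp add: power2_eq_square power3_eq_cube algebra_simps)
    also have "\<dots> \<ge> 0"
      using d by (intro add_nonneg_nonneg mult_nonneg_nonneg) auto
    finally show ?thesis by simp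
  qed
  finally have "(real y + 1) * (6 * real (card B)) \<le> (real y + 1) * (3 * x * (x + 1))"
    by (simp add: algebra_simps)
  then have "6 * real (card B) \<le> 3 * x * (x + 1)"
    by (subst (asm) mult_le_cancel_left_pos) auto
  then have "real (card B) \<le> x\<^sup>2 / 2 + x / 2"
    by (simp add: power2_eq_square algebra_simps)
  also have "x = root 3 3 * real n powr (1 / 3)"
    by (cases "n = 0") (simp_all add: x_def real_root_mult root_powr_inverse)
  also have "(root 3 3 * real n powr (1 / 3))\<^sup>2 = root 3 9 * real n powr (2 / 3)"
  proof -
    have "(root 3 3)\<^sup>2 = root 3 9"
      by (simp flip: real_root_power)
    moreover have "(real n powr (1 / 3))\<^sup>2 = real n powr (2 / 3)"
      by (simp add: power2_eq_square flip: powr_add)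
    ultimately show ?thesis
      by (simp add: power_mult_distrib)
  qed
  finally show ?thesis
    by simp
qed

section \<open>Parsings of two neighboring strings\<close>

text \<open>The roles are asymmetric: starts in \<open>S'\<close> are counted within the blocks of
  \<open>S\<close>. The opposite inequality comes from exchanging the strings.\<close>

locale neighbor_parsings =
  fixes w w' :: "'a list" and p :: nat and S S' :: "nat set"
  assumes same_length: "length w' = length w"
    and same_nth: "\<And>i. i < length w \<Longrightarrow> i \<noteq> p \<Longrightarrow> w' ! i = w ! i"
    and parse: "parse_starts w 0 S"
    and parse': "parse_starts w' 0 S'"
begin

abbreviation L :: "nat \<Rightarrow> nat" where "L \<equiv> match_length (length w) w"

text \<open>\<open>S\<close> records only starts, so one longest match is chosen anew for each of
  them; it may differ from the one stored in the block.\<close>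

definition source :: "nat \<Rightarrow> nat" where
  "source s = (SOME q. earlier_copy w s (L s) q)"

text \<open>The interval includes the literal character at \<open>s + L s\<close> that ends the
  block, so these intervals partition the positions.\<close>

definition inside :: "nat \<Rightarrow> nat set" where
  "inside s = S' \<inter> {s..s + L s}"

lemma start_bound: "s \<in> S \<Longrightarrow> s + L s < length w"
  using parse by (simp add: parse_starts_def)

lemma start_gap: "s \<in> S \<Longrightarrow> t \<in> S \<Longrightarrow> s < t \<Longrightarrow> s + L s < t"
  using parse by (simp add: parse_starts_def)

lemma finite_starts [simp]: "finite S" "finite S'"
  using parse parse' finite_subset[OF _ finite_atLeastLessThan] by (auto simp: parse_starts_def)

lemma source:
  assumes "s \<in> S"
  shows "source s + L s \<le> s" "\<And>k. k < L s \<Longrightarrow> w ! (source s + k) = w ! (s + k)"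
proof -
  have "earlier_copy w s (L s) (source s)"
    unfolding source_def using start_bound[OF assms]
    by (intro someI_ex[OF match_length_copy]) simp
  then show "source s + L s \<le> s" "\<And>k. k < L s \<Longrightarrow> w ! (source s + k) = w ! (s + k)"
    by (auto simp: earlier_copy_def)
qed

text \<open>With a copy of length \<open>e - a\<close> available, the block starting at
  \<open>a\<close> covers \<open>{a..e}\<close>, its literal included, and hence contains
  \<open>b\<close>.\<close>

lemma no_start_in_copy:
  assumes "a \<in> S'" "b \<in> S'" "a < b" "b \<le> e" "e < length w"
  shows "\<not> earlier_copy w' a (e - a) q"
proof
  assume "earlier_copy w' a (e - a) q"
  then have "e - a \<le> match_length (length w') w' a"
    using assms same_length by (intro match_length_ge) auto
  then show False
    using parse' assms unfolding parse_starts_def by fastforce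
qed

text \<open>The equality of block and source in \<open>w\<close> carries over to \<open>w'\<close>
  wherever neither side meets \<open>p\<close>. Starting at \<open>a\<close> instead of
  \<open>s\<close> shifts the source by the same amount.\<close>

lemma source_copy:
  assumes s: "s \<in> S" and "s \<le> a" "a \<le> f" "f \<le> s + L s"
    and "\<And>x. a \<le> x \<Longrightarrow> x < f \<Longrightarrow> x \<noteq> p \<and> source s + (x - s) \<noteq> p"
  shows "earlier_copy w' a (f - a) (source s + (a - s))"
  unfolding earlier_copy_def
proof (intro conjI allI impI)
  show "source s + (a - s) + (f - a) \<le> a"
    using source(1)[OF s] assms by linarith
next
  fix k assume k: "k < f - a"
  have "source s + (a - s) + k = source s + (a + k - s)"
    using assms by simp
  moreover have "w ! (source s + (a + k - s)) = w ! (a + k)"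
    using source(2)[OF s, of "a + k - s"] assms k by simp
  moreover have "a + k \<noteq> p" "source s + (a + k - s) \<noteq> p"
    using assms(5)[of "a + k"] k by auto
  moreover have "a + k < length w" "source s + (a + k - s) < length w"
    using start_bound[OF s] source(1)[OF s] assms k by linarith+
  ultimately show "w' ! (source s + (a - s) + k) = w' ! (a + k)"
    by (metis same_nth)
qed

text \<open>The condition on \<open>x\<close> omits the last character \<open>s + L s\<close> of the block, which is not copied.\<close>

definition touches :: "nat \<Rightarrow> nat \<Rightarrow> bool" where
  "touches s x \<longleftrightarrow> x \<in> {s..<s + L s} \<and> (x = p \<or> source s + (x - s) = p)"

text \<open>The source lies entirely before the block, so \<open>p\<close> cannot be in
  both.\<close>

lemma touches_unique:
  assumes "s \<in> S" "touches s x" "touches s y"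
  shows "x = y"
  using source(1)[OF assms(1)] assms(2,3) by (auto simp: touches_def)

text \<open>From any start in the block, the rest up to the literal is still a copy in
  \<open>w'\<close>, so the \<open>w'\<close>-block starting there reaches the end.\<close>

lemma card_inside_untouched:
  assumes s: "s \<in> S" and "\<And>x. \<not> touches s x"
  shows "card (inside s) \<le> 1"
proof (rule card_le_Suc_0I)
  fix a b assume ab: "a \<in> inside s" "b \<in> inside s" "a < b"
  then have "earlier_copy w' a (s + L s - a) (source s + (a - s))"
    using assms by (intro source_copy) (auto simp: inside_def touches_def)
  then show False
    using no_start_in_copy[of a b "s + L s"] ab start_bound[OF s] by (auto simp: inside_def)
qed

lemma card_inside:
  assumes s: "s \<in> S"
  shows "card (inside s) \<le> 2"
proof (cases "\<exists>m. touches s m")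
  case False
  then show ?thesis
    using card_inside_untouched[OF s] by force
next
  case True
  then obtain m where m: "touches s m" by blast
  then have m': "m < s + L s" by (auto simp: touches_def)
  have only: "x \<noteq> p \<and> source s + (x - s) \<noteq> p" if "x \<in> {s..<s + L s}" "x \<noteq> m" for x
    using touches_unique[OF s m, of x] that by (auto simp: touches_def)
  \<comment> \<open>A \<open>w'\<close>-block starting at \<open>a <= m\<close> can copy the
    positions before \<open>m\<close> and take \<open>m\<close> as its literal, so the next start
    exceeds \<open>m\<close>.\<close>
  have "card (inside s \<inter> {..m}) \<le> 1"
  proof (rule card_le_Suc_0I)
    fix a b assume ab: "a \<in> inside s \<inter> {..m}" "b \<in> inside s \<inter> {..m}" "a < b"
    then have "earlier_copy w' a (m - a) (source s + (a - s))"
      using m' by (intro source_copy[OF s] only) (auto simp: inside_def)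
    then show False
      using no_start_in_copy[of a b m] ab m' start_bound[OF s] by (auto simp: inside_def)
  qed
  \<comment> \<open>Beyond \<open>m\<close> neither block nor source meets \<open>p\<close>, so the
    untouched case applies.\<close>
  moreover have "card (inside s \<inter> {m<..}) \<le> 1"
  proof (rule card_le_Suc_0I)
    fix a b assume ab: "a \<in> inside s \<inter> {m<..}" "b \<in> inside s \<inter> {m<..}" "a < b"
    then have "earlier_copy w' a (s + L s - a) (source s + (a - s))"
      by (intro source_copy[OF s] only) (auto simp: inside_def)
    then show False
      using no_start_in_copy[of a b "s + L s"] ab start_bound[OF s] by (auto simp: inside_def)
  qed
  moreover have "(inside s \<inter> {..m}) \<union> (inside s \<inter> {m<..}) = inside s"
    by auto
  ultimately show ?thesis
    using card_Un_le[of "inside s \<inter> {..m}" "inside s \<inter> {m<..}"] by simp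
qed

section \<open>Counting the blocks that are split\<close>

text \<open>The block containing \<open>p\<close> is left out because its source need not contain
  \<open>p\<close>; it is counted separately.\<close>

definition split_starts :: "nat set" where
  "split_starts = {s \<in> S. card (inside s) = 2 \<and> p \<notin> {s..s + L s}}"

lemma finite_split_starts [simp]: "finite split_starts"
  by (simp add: split_starts_def)

text \<open>Two starts force the block to be touched, and \<open>p\<close> is outside the block, so
  it is the source that contains \<open>p\<close>.\<close>

lemma source_of_split:
  assumes "s \<in> split_starts"
  shows "source s \<le> p" "p < source s + L s"
proof -
  have s: "s \<in> S" "card (inside s) = 2" "p \<notin> {s..s + L s}"
    using assms by (auto simp: split_starts_def)
  then obtain x where "touches s x"
    using card_inside_untouched[of s] by fastforce
  then show "source s \<le> p" "p < source s + L s"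
    using s by (auto simp: touches_def)
qed

text \<open>An earlier block with the same source and length is a copy that avoids \<open>p\<close>, so the later
  block can still be copied in one piece.\<close>

lemma split_source_distinct:
  assumes "s \<in> split_starts" "t \<in> split_starts" "L s = L t" "source s = source t" "s < t"
  shows False
proof -
  have S: "s \<in> S" "t \<in> S"
    using assms by (auto simp: split_starts_def)
  \<comment> \<open>Since \<open>p\<close> lies in a source, it precedes both blocks, and
    \<open>w\<close> and \<open>w'\<close> agree on them.\<close>
  have ps: "p < s"
    using source_of_split[OF assms(1)] source(1)[OF S(1)] by linarith
  have gap: "s + L t < t"
    using start_gap[OF S assms(5)] assms(3) by simp
  have "card (inside t) \<le> 1"
  proof (rule card_le_Suc_0I)
    fix a b assume ab: "a \<in> inside t" "b \<in> inside t" "a < b"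
    have "earlier_copy w' a (t + L t - a) (s + (a - t))"
      unfolding earlier_copy_def
    proof (intro conjI allI impI)
      show "s + (a - t) + (t + L t - a) \<le> a"
        using ab gap by (auto simp: inside_def)
    next
      fix k assume k: "k < t + L t - a"
      define j where "j = a - t + k"
      have j: "j < L t" "s + (a - t) + k = s + j" "a + k = t + j"
        using ab k by (auto simp: inside_def j_def)
      have "w ! (s + j) = w ! (t + j)"
        using source(2)[OF S(1), of j] source(2)[OF S(2), of j] j assms(3,4) by simp
      then show "w' ! (s + (a - t) + k) = w' ! (a + k)"
        unfolding j(2,3)
        using same_nth[of "s + j"] same_nth[of "t + j"] start_bound[OF S(1)] start_bound[OF S(2)]
          j(1) ps assms(3,5) by simp
    qed
    then show False
      using no_start_in_copy[of a b "t + L t"] ab start_bound[OF S(2)] by (auto simp: inside_def)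
  qed
  then show False
    using assms(2) by (simp add: split_starts_def)
qed

text \<open>The sources are distinct intervals of length \<open>l\<close> containing
  \<open>p\<close>, and at most \<open>l\<close> starting positions are possible for these.\<close>

lemma card_split_starts_of_length: "card {s \<in> split_starts. L s = l} \<le> l"
proof -
  have "inj_on source {s \<in> split_starts. L s = l}"
  proof (rule inj_onI)
    fix s t assume "s \<in> {s \<in> split_starts. L s = l}" "t \<in> {s \<in> split_starts. L s = l}"
      "source s = source t"
    then show "s = t"
      using split_source_distinct[of s t] split_source_distinct[of t s]
      by (cases s t rule: linorder_cases) auto
  qed
  moreover have "source ` {s \<in> split_starts. L s = l} \<subseteq> {Suc p - l..p}"
    using source_of_split by fastforce
  ultimately have "card {s \<in> split_starts. L s = l} \<le> card {Suc p - l..p}"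
    by (intro card_inj_on_le) auto
  then show ?thesis by simp
qed

lemma sum_block_lengths: "(\<Sum>s\<in>split_starts. L s + 1) \<le> length w"
proof -
  have "(\<Sum>s\<in>split_starts. L s + 1) \<le> (\<Sum>s\<in>S. L s + 1)"
    by (intro sum_mono2) (auto simp: split_starts_def)
  also have "\<dots> = (\<Sum>s\<in>S. card {s..s + L s})"
    by simp
  also have "\<dots> = card (\<Union>s\<in>S. {s..s + L s})"
  proof (rule card_UN_disjoint[symmetric])
    show "\<forall>s\<in>S. \<forall>t\<in>S. s \<noteq> t \<longrightarrow> {s..s + L s} \<inter> {t..t + L t} = {}"
      using start_gap by (fastforce simp: neq_iff)
  qed auto
  also have "\<dots> \<le> card {..<length w}"
    using start_bound by (intro card_mono) fastforce+
  finally show ?thesis by simp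
qed

text \<open>Every block of \<open>w\<close> contains at most two starts of \<open>w'\<close>, and
  two only if it is split or contains \<open>p\<close>. By disjointness at most one block contains
  \<open>p\<close>.\<close>

lemma card_starts_le: "card S' \<le> card S + card split_starts + 1"
proof -
  define P where "P = {s \<in> S. p \<in> {s..s + L s}}"
  have "card P \<le> 1"
    using start_gap by (intro card_le_Suc_0I) (fastforce simp: P_def)
  have "S' \<subseteq> (\<Union>s\<in>S. inside s)"
    using parse parse' same_length unfolding parse_starts_def inside_def by fastforce
  then have "card S' \<le> card (\<Union>s\<in>S. inside s)"
    by (intro card_mono) (auto simp: inside_def)
  also have "\<dots> \<le> (\<Sum>s\<in>S. card (inside s))"
    by (intro card_UN_le) simp
  also have "\<dots> \<le> (\<Sum>s\<in>S. 1 + (if s \<in> split_starts \<union> P then 1 else 0))"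
  proof (rule sum_mono)
    fix s assume s: "s \<in> S"
    then show "card (inside s) \<le> 1 + (if s \<in> split_starts \<union> P then 1 else 0)"
      using card_inside[OF s] by (auto simp: split_starts_def P_def)
  qed
  also have "\<dots> = card S + (\<Sum>s\<in>S. if s \<in> split_starts \<union> P then 1 else 0)"
    by (simp only: sum.distrib) simp
  also have "\<dots> = card S + card (S \<inter> (split_starts \<union> P))"
    by (simp add: sum.If_cases del: Un_iff)
  also have "S \<inter> (split_starts \<union> P) = split_starts \<union> P"
    by (auto simp: split_starts_def P_def)
  finally show ?thesis
    using card_Un_le[of split_starts P] \<open>card P \<le> 1\<close> by linarith
qed

lemma card_starts_bound:
  "real (card S') \<le> real (card S) + (root 3 9 / 2 * real (length w) powr (2 / 3) +
     root 3 3 / 2 * real (length w) powr (1 / 3) + 1)"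
  using card_starts_le card_bound_real[OF finite_split_starts sum_block_lengths
      card_split_starts_of_length] by linarith

end

section \<open>From block counts to global sensitivity\<close>

lemma lz77_blocks_length_bound:
  assumes "neighbors w w'" "length w = n"
    and "lz77_blocks n w 0 bs" "lz77_blocks n w' 0 bs'"
  shows "real (length bs') \<le> real (length bs) +
    (root 3 9 / 2 * real n powr (2 / 3) + root 3 3 / 2 * real n powr (1 / 3) + 1)"
proof -
  have len: "length w' = n"
    using assms(1,2) by (simp add: neighbors_def)
  obtain p where p: "{i. i < length w \<and> w ! i \<noteq> w' ! i} = {p}"
    using assms(1) by (auto simp: neighbors_def card_1_singleton_iff)
  obtain S where S: "parse_starts w 0 S" "card S = length bs"
    using lz77_blocks_parse_starts assms(2,3) by blast
  obtain S' where S': "parse_starts w' 0 S'" "card S' = length bs'"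
    using lz77_blocks_parse_starts assms(4) len by blast
  interpret neighbor_parsings w w' p S S'
  proof
    fix i assume "i < length w" "i \<noteq> p"
    then show "w' ! i = w ! i"
      using p by fastforce
  qed (use S S' len assms(2) in auto)
  show ?thesis
    using card_starts_bound S(2) S'(2) assms(2) by simp
qed

lemma neighbors_sym: "neighbors w w' \<longleftrightarrow> neighbors w' w"
proof -
  have "{i. i < length w \<and> w ! i \<noteq> w' ! i} = {i. i < length w' \<and> w' ! i \<noteq> w ! i}"
    if "length w = length w'"
    using that by auto
  then show ?thesis
    unfolding neighbors_def by metis
qed

lemma length_binary [simp]: "length (binary k m) = k"
  by (simp add: binary_def)

lemma length_encode_blocks:
  "length (concat (map (encode_block \<Sigma> n) bs)) =
     length bs * (2 * nat \<lceil>log 2 (real n)\<rceil> + nat \<lceil>log 2 (real (card \<Sigma>))\<rceil>)"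
  by (induction bs) (auto simp: encode_block_def)

text \<open>The one-sided bound is assumed for all ordered pairs, so symmetry of
  \<open>neighbors\<close> gives the absolute value. Finiteness of \<open>\<Sigma>\<close> makes
  \<open>Max\<close> range over a finite set.\<close>

lemma global_sensitivity_le:
  assumes "finite \<Sigma>" "0 \<le> B"
    and "\<And>w w'. w \<in> lists \<Sigma> \<Longrightarrow> w' \<in> lists \<Sigma> \<Longrightarrow> length w = n \<Longrightarrow> neighbors w w' \<Longrightarrow>
           real (length (f w)) \<le> real (length (f w')) + B"
  shows "global_sensitivity \<Sigma> f n \<le> B"
proof -
  let ?d = "\<lambda>w w'. \<bar>real (length (f w)) - real (length (f w'))\<bar>"
  let ?A = "{?d w w' | w w'. w \<in> lists \<Sigma> \<and> w' \<in> lists \<Sigma> \<and> length w = n \<and> neighbors w w'}"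
  let ?X = "{w. set w \<subseteq> \<Sigma> \<and> length w = n}"
  have "?A \<subseteq> (\<lambda>(w, w'). ?d w w') ` (?X \<times> ?X)"
    by (auto simp: neighbors_def lists_eq_set)
  moreover have "finite ?X"
    using assms(1) by (rule finite_lists_length_eq)
  ultimately have "finite ?A"
    by (meson finite_SigmaI finite_imageI finite_subset)
  moreover have "?d w w' \<le> B"
    if "w \<in> lists \<Sigma>" "w' \<in> lists \<Sigma>" "length w = n" "neighbors w w'" for w w'
  proof -
    have "length w' = n"
      using that by (simp add: neighbors_def)
    then show ?thesis
      using assms(3)[of w w'] assms(3)[of w' w] that neighbors_sym[of w w'] by auto
  qed
  ultimately show ?thesis
    unfolding global_sensitivity_def using assms(2) by (subst Max_le_iff) auto
qed

text \<open>The alphabet term \<open>c\<close> is constant in \<open>n\<close>, so the logarithm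
  absorbs it.\<close>

lemma bound_bigo:
  "(\<lambda>n::nat. (a * real n powr (2 / 3) + b * real n powr (1 / 3) + 1) *
      (2 * real_of_int \<lceil>log 2 (real n)\<rceil> + c)) \<in> O(\<lambda>n. real n powr (2 / 3) * log 2 (real n))"
proof (rule landau_o.big.mult)
  show "(\<lambda>n::nat. a * real n powr (2 / 3) + b * real n powr (1 / 3) + 1) \<in> O(\<lambda>n. real n powr (2 / 3))"
    by real_asymp
  have "(\<lambda>n::nat. real_of_int \<lceil>log 2 (real n)\<rceil>) \<in> O(\<lambda>n. log 2 (real n))"
    by real_asymp
  moreover have "(\<lambda>n::nat. c) \<in> O(\<lambda>n. log 2 (real n))"
    by real_asymp
  ultimately show "(\<lambda>n::nat. 2 * real_of_int \<lceil>log 2 (real n)\<rceil> + c) \<in> O(\<lambda>n. log 2 (real n))"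
    by (intro sum_in_bigo) simp_all
qed

theorem theorem3:
  fixes \<Sigma> :: "'a set" and compress :: "'a list \<Rightarrow> bool list"
  assumes "finite \<Sigma>" and "\<Sigma> \<noteq> {}"
    and "lz77_compressor (\<lambda>n. n) \<Sigma> compress"
  shows "let bound = (\<lambda>n::nat.
             (root 3 9 / 2 * real n powr (2 / 3) + root 3 3 / 2 * real n powr (1 / 3) + 1) *
             (2 * real_of_int \<lceil>log 2 (real n)\<rceil> + real_of_int \<lceil>log 2 (real (card \<Sigma>))\<rceil>))
         in (\<forall>n\<ge>1. global_sensitivity \<Sigma> compress n \<le> bound n) \<and>
            bound \<in> O(\<lambda>n. real n powr (2 / 3) * log 2 (real n))"
  unfolding Let_def
proof (intro conjI allI impI)
  fix n :: nat assume n: "1 \<le> n"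
  define K where "K = root 3 9 / 2 * real n powr (2 / 3) + root 3 3 / 2 * real n powr (1 / 3) + 1"
  define b where "b = 2 * nat \<lceil>log 2 (real n)\<rceil> + nat \<lceil>log 2 (real (card \<Sigma>))\<rceil>"
  have "card \<Sigma> \<ge> 1"
    using assms(1,2) by (simp add: Suc_le_eq card_gt_0_iff)
  then have "0 \<le> log 2 (real n)" "0 \<le> log 2 (real (card \<Sigma>))"
    using n by simp_all
  \<comment> \<open>Both logarithms are nonnegative, so \<open>nat\<close> does not change their
    ceilings.\<close>
  then have b: "2 * real_of_int \<lceil>log 2 (real n)\<rceil> + real_of_int \<lceil>log 2 (real (card \<Sigma>))\<rceil> = real b"
    by (simp add: b_def)
  have blocks: "\<exists>bs. lz77_blocks n w 0 bs \<and> length (compress w) = length bs * b"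
    if "w \<in> lists \<Sigma>" "length w = n" for w
    using assms(3) that length_encode_blocks unfolding lz77_compressor_def b_def by metis
  have "global_sensitivity \<Sigma> compress n \<le> K * real b"
  proof (rule global_sensitivity_le[OF assms(1)])
    show "0 \<le> K * real b"
      by (simp add: K_def)
  next
    fix w w' assume w: "w \<in> lists \<Sigma>" "w' \<in> lists \<Sigma>" "length w = n" "neighbors w w'"
    then have len': "length w' = n"
      by (simp add: neighbors_def)
    obtain bs where bs: "lz77_blocks n w 0 bs" "length (compress w) = length bs * b"
      using blocks w by blast
    obtain bs' where bs': "lz77_blocks n w' 0 bs'" "length (compress w') = length bs' * b"
      using blocks w len' by blast
    \<comment> \<open>The length bound is applied with the two strings exchanged.\<close>
    have "real (length bs) \<le> real (length bs') + K"
      unfolding K_def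
      using w(4) len' bs'(1) bs(1) by (intro lz77_blocks_length_bound) (auto simp: neighbors_sym)
    then have "real (length bs) * real b \<le> (real (length bs') + K) * real b"
      by (intro mult_right_mono) auto
    then show "real (length (compress w)) \<le> real (length (compress w')) + K * real b"
      by (simp add: bs bs' algebra_simps)
  qed
  then show "global_sensitivity \<Sigma> compress n \<le>
      (root 3 9 / 2 * real n powr (2 / 3) + root 3 3 / 2 * real n powr (1 / 3) + 1) *
      (2 * real_of_int \<lceil>log 2 (real n)\<rceil> + real_of_int \<lceil>log 2 (real (card \<Sigma>))\<rceil>)"
    by (simp only: K_def b)
qed (rule bound_bigo)

end
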